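(* Let $K_n=(V,E)$ be the complete graph with $|V|=n\ge 4$. Then the graph of the cone partition for the min-cut problem with non-negative edges, whose vertices are the cones $K^{+}_{\min}(X)$ for all cuts $X$ and whose edges join adjacent cones, has diameter exactly $2$.
   Context: Let $d=\binom{n}{2}=|E|$. For $S\subseteq V$, the cut vector $\mathbf{v}(S)\in\{0,1\}^{d}$ has coordinates indexed by edges $\{i,j\}\in E$, with $\mathbf{v}(S)_{i,j}=1$ if $|S\cap\{i,j\}|=1$ and $0$ otherwise. A cut is a nonempty proper subset $X\subset V$, where $X$ and its complement $V\setminus X$ are identified; the empty cut is excluded, so there are $2^{n-1}-1$ cuts. For a cut $X$, $K^{+}_{\min}(X)=\{\mathbf{c}\in\mathbb{R}^{d}:\ \mathbf{c}\ge\mathbf{0},\ \langle\mathbf{c},\mathbf{v}(X)\rangle\le\langle\mathbf{c},\mathbf{v}(Y)\rangle \text{ for all cuts } Y\}$. Two cones $K^{+}_{\min}(X),K^{+}_{\min}(Y)$ with $X\ne Y$ are adjacent if $\dim\big(K^{+}_{\min}(X)\cap K^{+}_{\min}(Y)\big)=d-1$. The graph of the cone partition has one vertex per cut (the cone $K^{+}_{\min}(X)$) and an edge between two cones iff they are adjacent. *)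

theory Defs
  imports "HOL-Analysis.Analysis" "Graph_Theory.Shortest_Path"
begin

text \<open>The edges of the complete graph on the vertex type \<open>'v\<close>. The class \<open>card2\<close> (at least two
  vertices) is what makes this set of edges nonempty.\<close>

typedef ('v :: card2) edge = "{e :: 'v set. card e = 2}"
proof -
  have "\<exists>e \<subseteq> (UNIV :: 'v set). card e = 2"
    using two_le_card [where 'a = 'v] by (metis obtain_subset_with_card_n)
  then show ?thesis by blast
qed

instance edge :: (card2) finite
proof
  have "(UNIV :: 'a edge set) = Abs_edge ` {e :: 'a set. card e = 2}"
    by (metis type_definition.Abs_image [OF type_definition_edge])
  then show "finite (UNIV :: 'a edge set)" by (metis finite_code finite_imageI)
qed

lemma card_edge: "CARD('v :: card2 edge) = CARD('v) choose 2"
proof -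
  have "CARD('v edge) = card {e :: 'v set. card e = 2}"
    by (rule type_definition.card [OF type_definition_edge])
  also have "\<dots> = CARD('v) choose 2"
    using n_subsets [of "UNIV :: 'v set" 2] by simp
  finally show ?thesis .
qed

definition cut_vector :: "'v :: card2 set \<Rightarrow> real ^ 'v edge" where
  "cut_vector S = (\<chi> e. if card (S \<inter> Rep_edge e) = 1 then 1 else 0)"

definition is_cut :: "'v :: card2 set \<Rightarrow> bool" where
  "is_cut X \<longleftrightarrow> X \<noteq> {} \<and> X \<noteq> UNIV"

definition min_cut_cone :: "'v :: card2 set \<Rightarrow> (real ^ 'v edge) set" where
  "min_cut_cone X =
     {c. (\<forall>e. 0 \<le> c $ e) \<and> (\<forall>Y. is_cut Y \<longrightarrow> c \<bullet> cut_vector X \<le> c \<bullet> cut_vector Y)}"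

lemma cut_vector_Compl: "cut_vector (- S) = cut_vector S"
proof -
  have "card (- S \<inter> Rep_edge e) = 1 \<longleftrightarrow> card (S \<inter> Rep_edge e) = 1" for e
  proof -
    have "card (Rep_edge e) = 2" using Rep_edge [of e] by simp
    moreover have "card (Rep_edge e) = card (S \<inter> Rep_edge e) + card (- S \<inter> Rep_edge e)"
      by (subst card_Un_disjoint [symmetric]) (auto intro: arg_cong [where f = card])
    ultimately show ?thesis by linarith
  qed
  then show ?thesis by (simp add: cut_vector_def)
qed

lemma min_cut_cone_Compl: "min_cut_cone (- X) = min_cut_cone X"
  by (simp add: min_cut_cone_def cut_vector_Compl)

text \<open>Cuts up to complementation, each represented by the class \<open>{X, V - X}\<close>.\<close>

definition cuts :: "'v :: card2 set set set" where
  "cuts = {{X, - X} |X. is_cut X}"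

lemma card_cuts: "card (cuts :: 'v :: card2 set set set) = 2 ^ (CARD('v) - 1) - 1"
proof -
  have U: "\<Union> (cuts :: 'v set set set) = UNIV - {{}, UNIV}"
    by (auto simp: cuts_def is_cut_def)
  have ne: "X \<noteq> - X" for X :: "'v set" by blast
  have "2 * card (cuts :: 'v set set set) = card (\<Union> (cuts :: 'v set set set))"
  proof (rule card_partition)
    show "card c = 2" if "c \<in> cuts" for c :: "'v set set"
      using that ne by (auto simp: cuts_def)
    show "c1 \<inter> c2 = {}" if "c1 \<in> cuts" "c2 \<in> cuts" "c1 \<noteq> c2" for c1 c2 :: "'v set set"
      using that by (auto simp: cuts_def)
  qed simp_all
  also have "\<dots> = 2 ^ CARD('v) - 2"
    unfolding U by (subst card_Diff_subset) (auto simp: card_UNIV_set)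
  also have "\<dots> = 2 * (2 ^ (CARD('v) - 1) - 1)"
    by (cases "CARD('v)") auto
  finally show ?thesis by simp
qed

text \<open>The common value of \<^const>\<open>min_cut_cone\<close> on the two representatives of a cut.\<close>

definition cone_of_cut :: "'v :: card2 set set \<Rightarrow> (real ^ 'v edge) set" where
  "cone_of_cut C = the_elem (min_cut_cone ` C)"

lemma cone_of_cut: "cone_of_cut {X, - X} = min_cut_cone X"
  by (simp add: cone_of_cut_def min_cut_cone_Compl)

definition adjacent_cuts :: "'v :: card2 set set \<Rightarrow> 'v set set \<Rightarrow> bool" where
  "adjacent_cuts C D \<longleftrightarrow>
     C \<noteq> D \<and> aff_dim (cone_of_cut C \<inter> cone_of_cut D) = int (CARD('v) choose 2) - 1"

text \<open>An undirected graph is a symmetric digraph, each edge being a pair of opposite arcs.\<close>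

definition cone_graph :: "('v :: card2 set set, 'v set set \<times> 'v set set) pre_digraph" where
  "cone_graph =
     \<lparr>verts = cuts, arcs = {(C, D). C \<in> cuts \<and> D \<in> cuts \<and> adjacent_cuts C D},
      tail = fst, head = snd\<rparr>"

lemma graph_cone_graph: "graph (cone_graph :: ('v :: card2 set set, _) pre_digraph)"
  by unfold_locales
     (auto simp: cone_graph_def adjacent_cuts_def arc_to_ends_def symmetric_def arcs_ends_def
       sym_def Int_commute image_iff)

text \<open>Distance is the least number of arcs on a walk, so a disconnected graph has diameter \<open>\<infinity>\<close>.\<close>

definition graph_diameter :: "('a, 'b) pre_digraph \<Rightarrow> ereal" where
  "graph_diameter G = (SUP u \<in> verts G. SUP v \<in> verts G. wf_digraph.\<mu> G (\<lambda>_. 1) u v)"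

end

theory Submission
  imports Defs
begin

text \<open>Two distinct cuts have adjacent cones exactly when they do not cross, i.e. when suitable
  representatives \<open>X\<close>, \<open>Y\<close> are disjoint. If they are, let \<open>R\<close> be the rest of the vertices and
  distribute weight 1 over the edges between \<open>X\<close> and \<open>R\<close>, weight 1 over those between \<open>Y\<close> and \<open>R\<close>,
  and weight 1/2 over those between \<open>X\<close> and \<open>Y\<close>, giving each remaining edge weight 2: then \<open>X\<close> and
  \<open>Y\<close> have value 3/2 and every other cut has value at least 2. If they cross, submodularity makes
  all edges between \<open>X - Y\<close> and \<open>Y - X\<close>, and all edges between \<open>X \<inter> Y\<close> and the complement of
  \<open>X \<union> Y\<close>, vanish on the common face, which thus has codimension at least 2. Finally, two crossing
  cuts \<open>X\<close>, \<open>Y\<close> have the common neighbour \<open>X \<inter> Y\<close>.\<close>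

section \<open>Edges between vertex sets and the value of a cut\<close>

lemma edge_cases:
  obtains a b where "a \<noteq> b" "Rep_edge e = {a, b}"
  using Rep_edge [of e] by (auto simp: card_2_iff)

lemma Rep_Abs_edge: "a \<noteq> b \<Longrightarrow> Rep_edge (Abs_edge {a, b}) = {a, b}"
  by (simp add: Abs_edge_inverse)

lemma cut_vector_nth:
  assumes "Rep_edge e = {a, b}"
  shows "cut_vector S $ e = (if (a \<in> S) \<noteq> (b \<in> S) then 1 else 0)"
proof -
  have "card (Rep_edge e) = 2" using Rep_edge [of e] by simp
  with assms have "a \<noteq> b" by auto
  then show ?thesis using assms by (auto simp: cut_vector_def Int_insert_right)
qed

definition edges_between :: "'v :: card2 set \<Rightarrow> 'v set \<Rightarrow> 'v edge set" where
  "edges_between S T = {e. \<exists>a\<in>S. \<exists>b\<in>T. Rep_edge e = {a, b}}"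

lemma mem_edges_between:
  assumes "Rep_edge e = {a, b}"
  shows "e \<in> edges_between S T \<longleftrightarrow> a \<in> S \<and> b \<in> T \<or> a \<in> T \<and> b \<in> S"
  by (auto simp: edges_between_def assms doubleton_eq_iff)

lemma edges_between_commute: "edges_between S T = edges_between T S"
  unfolding edges_between_def by (metis insert_commute)

lemma edges_between_Un: "edges_between S (T \<union> U) = edges_between S T \<union> edges_between S U"
  unfolding edges_between_def by blast

text \<open>An edge of the second set has an endpoint in \<open>U\<close>, whereas both endpoints of
  an edge of the first lie in \<open>S \<union> T\<close>, which misses \<open>U\<close>.\<close>

lemma edges_between_disjoint:
  assumes "S \<inter> U = {}" "T \<inter> U = {}"
  shows "edges_between S T \<inter> edges_between R U = {}"
proof -
  have False if "e \<in> edges_between S T" "e \<in> edges_between R U" for e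
    using that assms by (cases e rule: edge_cases) (auto simp: mem_edges_between)
  then show ?thesis by blast
qed

lemma edges_between_nonempty:
  assumes "S \<inter> T = {}" "S \<noteq> {}" "T \<noteq> {}"
  shows "edges_between S T \<noteq> {}"
proof -
  obtain a b where "a \<in> S" "b \<in> T" using assms by blast
  moreover from this assms have "a \<noteq> b" by blast
  ultimately show ?thesis unfolding edges_between_def using Rep_Abs_edge by blast
qed

lemma inner_cut_vector: "c \<bullet> cut_vector S = (\<Sum>e\<in>edges_between S (- S). c $ e)"
proof -
  have "cut_vector S $ e = (if e \<in> edges_between S (- S) then 1 else 0)" for e
  proof (cases e rule: edge_cases)
    case (1 a b)
    then show ?thesis by (auto simp: cut_vector_nth mem_edges_between)
  qed
  then have "c \<bullet> cut_vector S = (\<Sum>e\<in>UNIV. if e \<in> edges_between S (- S) then c $ e else 0)"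
    by (auto simp: inner_vec_def intro!: sum.cong)
  also have "\<dots> = (\<Sum>e\<in>edges_between S (- S). c $ e)"
    by (simp add: sum.If_cases)
  finally show ?thesis .
qed

lemma inner_cut_vector_Un:
  assumes "- S = T \<union> U" "T \<inter> U = {}"
  shows "c \<bullet> cut_vector S = (\<Sum>e\<in>edges_between S T. c $ e) + (\<Sum>e\<in>edges_between S U. c $ e)"
proof -
  have "edges_between S T \<inter> edges_between S U = {}"
    using assms by (intro edges_between_disjoint) blast+
  then show ?thesis
    by (simp add: inner_cut_vector assms(1) edges_between_Un sum.union_disjoint)
qed

lemma cut_vector_cong_Compl: "Z = X \<or> Z = - X \<Longrightarrow> cut_vector Z = cut_vector X"
  using cut_vector_Compl by blast

section \<open>Adjacency of non-crossing cuts\<close>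

text \<open>A cut that splits none of the three blocks is a union of blocks; being nonempty and
  proper, it is one block or the complement of one. Comparing cut vectors instead of sets merges
  complementary representatives.\<close>

lemma cut_vector_cases [consumes 3]:
  assumes "is_cut Z" and "P \<inter> Q = {}" "R = - (P \<union> Q)"
  obtains "cut_vector Z = cut_vector P" | "cut_vector Z = cut_vector Q"
    | "cut_vector Z = cut_vector R"
    | S a b where "S = P \<or> S = Q \<or> S = R" "a \<in> S" "b \<in> S" "a \<in> Z" "b \<notin> Z"
proof (cases "\<exists>S a b. (S = P \<or> S = Q \<or> S = R) \<and> a \<in> S \<and> b \<in> S \<and> a \<in> Z \<and> b \<notin> Z")
  case True
  then show ?thesis using that(4) by blast
next
  case False
  then have "P \<subseteq> Z \<or> P \<subseteq> - Z" "Q \<subseteq> Z \<or> Q \<subseteq> - Z" "R \<subseteq> Z \<or> R \<subseteq> - Z"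
    by blast+
  moreover have "Z \<noteq> {}" "Z \<noteq> UNIV" using assms(1) by (simp_all add: is_cut_def)
  moreover have "\<lbrakk>P \<subseteq> Z; Q \<subseteq> Z; R \<subseteq> Z\<rbrakk> \<Longrightarrow> Z = UNIV" "\<lbrakk>P \<subseteq> - Z; Q \<subseteq> - Z; R \<subseteq> - Z\<rbrakk> \<Longrightarrow> Z = {}"
    "\<lbrakk>P \<subseteq> Z; Q \<subseteq> Z; R \<subseteq> - Z\<rbrakk> \<Longrightarrow> Z = - R" "\<lbrakk>P \<subseteq> - Z; Q \<subseteq> - Z; R \<subseteq> Z\<rbrakk> \<Longrightarrow> Z = R"
    "\<lbrakk>P \<subseteq> Z; Q \<subseteq> - Z; R \<subseteq> Z\<rbrakk> \<Longrightarrow> Z = - Q" "\<lbrakk>P \<subseteq> - Z; Q \<subseteq> Z; R \<subseteq> - Z\<rbrakk> \<Longrightarrow> Z = Q"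
    "\<lbrakk>P \<subseteq> - Z; Q \<subseteq> Z; R \<subseteq> Z\<rbrakk> \<Longrightarrow> Z = - P" "\<lbrakk>P \<subseteq> Z; Q \<subseteq> - Z; R \<subseteq> - Z\<rbrakk> \<Longrightarrow> Z = P"
    using assms(2,3) by blast+
  ultimately have "(Z = P \<or> Z = - P) \<or> (Z = Q \<or> Z = - Q) \<or> (Z = R \<or> Z = - R)"
    by argo
  then show ?thesis using that(1-3) cut_vector_cong_Compl by metis
qed

lemma exists_weights_disjoint_cuts_minimal:
  fixes P Q :: "'v :: card2 set"
  assumes "P \<inter> Q = {}" "P \<noteq> {}" "Q \<noteq> {}" "P \<union> Q \<noteq> UNIV"
  obtains c where "\<And>e. 0 < c $ e" "c \<bullet> cut_vector P = c \<bullet> cut_vector Q"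
    "\<And>Z. \<lbrakk>is_cut Z; cut_vector Z \<noteq> cut_vector P; cut_vector Z \<noteq> cut_vector Q\<rbrakk>
      \<Longrightarrow> c \<bullet> cut_vector P < c \<bullet> cut_vector Z"
proof -
  define R where "R = - (P \<union> Q)"
  have R: "R \<noteq> {}" "P \<inter> R = {}" "Q \<inter> R = {}" "R \<inter> P = {}" "R \<inter> Q = {}" "Q \<inter> P = {}"
    and Compl: "- P = Q \<union> R" "- Q = P \<union> R" "- R = P \<union> Q"
    using assms by (auto simp: R_def)
  let ?J = "edges_between"
  \<comment> \<open>Spreading each total evenly over its edge set makes every entry positive, as the
    later open set requires.\<close>
  define c :: "real ^ 'v edge" where
    "c = (\<chi> e. if e \<in> ?J P R then 1 / card (?J P R) else if e \<in> ?J Q R then 1 / card (?J Q R)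
      else if e \<in> ?J P Q then 1 / (2 * card (?J P Q)) else 2)"
  have ne: "card (?J P R) > 0" "card (?J Q R) > 0" "card (?J P Q) > 0"
    using assms R by (simp_all add: card_gt_0_iff edges_between_nonempty)
  have disj: "?J P Q \<inter> ?J P R = {}" "?J P Q \<inter> ?J Q R = {}" "?J Q R \<inter> ?J P R = {}"
    using edges_between_disjoint[of P R Q P] edges_between_disjoint[of P R Q Q]
      edges_between_disjoint[of Q P R R] assms R by (simp_all add: edges_between_commute)
  have pos: "0 < c $ e" for e
    using ne by (auto simp: c_def)
  have PR: "(\<Sum>e\<in>?J P R. c $ e) = 1"
    using ne by (simp add: c_def card_gt_0_iff)
  have "(\<Sum>e\<in>?J Q R. c $ e) = (\<Sum>e\<in>?J Q R. 1 / card (?J Q R))"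
    using disj by (intro sum.cong) (auto simp: c_def)
  then have QR: "(\<Sum>e\<in>?J Q R. c $ e) = 1"
    using ne by (simp add: card_gt_0_iff)
  have "(\<Sum>e\<in>?J P Q. c $ e) = (\<Sum>e\<in>?J P Q. 1 / (2 * card (?J P Q)))"
    using disj by (intro sum.cong) (auto simp: c_def)
  then have PQ: "(\<Sum>e\<in>?J P Q. c $ e) = 1 / 2"
    using ne by (simp add: card_gt_0_iff)
  have P: "c \<bullet> cut_vector P = 3 / 2"
    using PR PQ R by (simp add: inner_cut_vector_Un[OF Compl(1)])
  have Q: "c \<bullet> cut_vector Q = 3 / 2"
    using QR PQ R by (simp add: inner_cut_vector_Un[OF Compl(2)] edges_between_commute)
  have RR: "c \<bullet> cut_vector R = 2"
    using QR PR assms(1) by (simp add: inner_cut_vector_Un[OF Compl(3)] edges_between_commute)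
  have "2 \<le> c \<bullet> cut_vector Z"
    if "is_cut Z" "cut_vector Z \<noteq> cut_vector P" "cut_vector Z \<noteq> cut_vector Q" for Z
    using that(1) assms(1) R_def
  proof (cases rule: cut_vector_cases)
    case 3
    then show ?thesis using RR by simp
  next
    case (4 S a b)
    then have ab: "a \<noteq> b" by blast
    \<comment> \<open>Both endpoints of \<open>e\<close> lie in one block, so \<open>e\<close>
      avoids the three edge sets and gets the default weight 2. As \<open>Z\<close> cuts
      \<open>e\<close>, this single edge already reaches the bound.\<close>
    define e where "e = Abs_edge {a, b}"
    have e: "Rep_edge e = {a, b}" using ab by (simp add: e_def Rep_Abs_edge)
    have "e \<notin> ?J P R" "e \<notin> ?J Q R" "e \<notin> ?J P Q"
      using 4 assms(1) R by (auto simp: mem_edges_between[OF e])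
    then have "2 = c $ e" by (simp add: c_def)
    also have "\<dots> \<le> (\<Sum>e\<in>?J Z (- Z). c $ e)"
      using 4 e pos by (intro member_le_sum) (auto simp: mem_edges_between less_imp_le)
    finally show ?thesis by (simp add: inner_cut_vector)
  qed (use that in simp_all)
  then show thesis using that[of c] pos P Q by force
qed

text \<open>The common face is squeezed between the hyperplane \<open>H\<close> and its relatively
  open part \<open>H \<inter> U\<close>. The latter is nonempty by the weights just built, so all
  three have the dimension of \<open>H\<close>.\<close>

lemma aff_dim_disjoint_min_cut_cones:
  fixes P Q :: "'v :: card2 set"
  assumes "P \<inter> Q = {}" "P \<noteq> {}" "Q \<noteq> {}" "P \<union> Q \<noteq> UNIV"
  shows "aff_dim (min_cut_cone P \<inter> min_cut_cone Q) = int (CARD('v) choose 2) - 1"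
proof -
  define H where "H = {c. (cut_vector P - cut_vector Q) \<bullet> c = 0}"
  \<comment> \<open>Openness holds because only finitely many strict inequalities occur. Cuts with
    the vector of \<open>P\<close> or \<open>Q\<close> are left out: on \<open>H\<close> they have
    the same value as \<open>P\<close>.\<close>
  define U where "U = (\<Inter>e. {c. 0 < c $ e}) \<inter>
    (\<Inter>Z\<in>{Z. is_cut Z \<and> cut_vector Z \<noteq> cut_vector P \<and> cut_vector Z \<noteq> cut_vector Q}.
      {c. c \<bullet> cut_vector P < c \<bullet> cut_vector Z})"
  have cuts: "is_cut P" "is_cut Q" using assms by (auto simp: is_cut_def)
  \<comment> \<open>An edge from \<open>P\<close> to the remaining vertices is cut by
    \<open>P\<close> but not by \<open>Q\<close>, so the normal vector of \<open>H\<close> is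
    nonzero.\<close>
  obtain a b where ab: "a \<in> P" "b \<notin> P" "b \<notin> Q" using assms by blast
  then have "a \<noteq> b" "a \<notin> Q" using assms by auto
  with ab have "cut_vector P $ Abs_edge {a, b} \<noteq> cut_vector Q $ Abs_edge {a, b}"
    by (simp add: cut_vector_nth[OF Rep_Abs_edge])
  then have "cut_vector P - cut_vector Q \<noteq> 0" by auto
  then have "aff_dim H = int (DIM(real ^ 'v edge)) - 1"
    unfolding H_def by (simp add: Suc_leI)
  then have dimH: "aff_dim H = int (CARD('v) choose 2) - 1"
    by (simp add: card_edge)
  have H: "c \<in> H \<longleftrightarrow> c \<bullet> cut_vector P = c \<bullet> cut_vector Q" for c
    by (simp add: H_def inner_diff_left inner_commute[of c])
  have "open U"
    unfolding U_def
    by (intro open_Int open_INT ballI open_Collect_less continuous_intros finite)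
  moreover have "H \<inter> U \<noteq> {}"
  proof -
    obtain c where "\<And>e. 0 < c $ e" "c \<bullet> cut_vector P = c \<bullet> cut_vector Q"
      "\<And>Z. \<lbrakk>is_cut Z; cut_vector Z \<noteq> cut_vector P; cut_vector Z \<noteq> cut_vector Q\<rbrakk>
        \<Longrightarrow> c \<bullet> cut_vector P < c \<bullet> cut_vector Z"
      using exists_weights_disjoint_cuts_minimal[OF assms] by blast
    then have "c \<in> H" "c \<in> U" by (auto simp: H U_def)
    then show ?thesis by blast
  qed
  moreover have "convex H" unfolding H_def by (rule convex_hyperplane)
  ultimately have "aff_dim (H \<inter> U) = aff_dim H"
    by (simp add: aff_dim_convex_Int_open)
  moreover have "H \<inter> U \<subseteq> min_cut_cone P \<inter> min_cut_cone Q"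
  proof
    fix c assume c: "c \<in> H \<inter> U"
    then have "c \<bullet> cut_vector P \<le> c \<bullet> cut_vector Z" if "is_cut Z" for Z
      using that by (cases "cut_vector Z = cut_vector P \<or> cut_vector Z = cut_vector Q")
        (auto simp: H U_def less_imp_le)
    moreover have "0 \<le> c $ e" for e
      using c by (auto simp: U_def less_imp_le)
    ultimately show "c \<in> min_cut_cone P \<inter> min_cut_cone Q"
      using c by (auto simp: H min_cut_cone_def)
  qed
  moreover have "min_cut_cone P \<inter> min_cut_cone Q \<subseteq> H"
    using cuts by (auto simp: H min_cut_cone_def intro!: antisym)
  ultimately have "aff_dim H \<le> aff_dim (min_cut_cone P \<inter> min_cut_cone Q)"
    "aff_dim (min_cut_cone P \<inter> min_cut_cone Q) \<le> aff_dim H"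
    by (metis aff_dim_subset)+
  then show ?thesis using dimH by linarith
qed

lemma cut_pair_eq_iff: "{X, - X} = {Y, - Y} \<longleftrightarrow> X = Y \<or> X = - Y" for X Y :: "'a set"
  by (auto simp: doubleton_eq_iff)

lemma adjacent_cuts_disjoint:
  assumes "P \<inter> Q = {}" "P \<noteq> {}" "Q \<noteq> {}" "P \<union> Q \<noteq> UNIV"
  shows "adjacent_cuts {P, - P} {Q, - Q}"
  unfolding adjacent_cuts_def cone_of_cut aff_dim_disjoint_min_cut_cones[OF assms]
  using assms by (auto simp: cut_pair_eq_iff)

text \<open>Passing from \<open>X\<close> to its complement turns strict inclusion into disjointness
  with a nonempty remainder \<open>X - A\<close>.\<close>

lemma adjacent_cuts_psubset:
  assumes "A \<subset> X" "A \<noteq> {}" "X \<noteq> UNIV"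
  shows "adjacent_cuts {A, - A} {X, - X}"
proof -
  have "adjacent_cuts {A, - A} {- X, - (- X)}"
    using assms by (intro adjacent_cuts_disjoint) auto
  then show ?thesis by (simp add: insert_commute)
qed

lemma adjacent_cuts_commute: "adjacent_cuts C D \<longleftrightarrow> adjacent_cuts D C"
  by (auto simp: adjacent_cuts_def Int_commute)

section \<open>Non-adjacency of crossing cuts\<close>

lemma cut_vector_submodular:
  "cut_vector (X \<inter> Y) $ e + cut_vector (X \<union> Y) $ e \<le> cut_vector X $ e + cut_vector Y $ e"
  by (cases e rule: edge_cases) (auto simp: cut_vector_nth)

text \<open>Minimality of \<open>X\<close> and \<open>Y\<close> against the cuts
  \<open>X \<inter> Y\<close> and \<open>X \<union> Y\<close> reverses the submodular inequality.
  Its slack is a sum of nonnegative terms over the edges, so each term vanishes.\<close>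

lemma min_cut_cones_vanish_crossing_edge:
  assumes c: "c \<in> min_cut_cone X \<inter> min_cut_cone Y"
    and "X \<inter> Y \<noteq> {}" "X \<union> Y \<noteq> UNIV"
    and ab: "a \<in> X - Y" "b \<in> Y - X"
  shows "c $ Abs_edge {a, b} = 0"
proof -
  define e where "e = Abs_edge {a, b}"
  have e: "Rep_edge e = {a, b}" using ab unfolding e_def by (intro Rep_Abs_edge) blast
  \<comment> \<open>The edgewise submodular slack. It is 2 on \<open>{a, b}\<close>: both
    \<open>X\<close> and \<open>Y\<close> separate \<open>a\<close> from \<open>b\<close>, while the
    intersection and the union do not.\<close>
  define s where "s = cut_vector X + cut_vector Y - cut_vector (X \<inter> Y) - cut_vector (X \<union> Y)"
  have c0: "0 \<le> c $ e" for e using c by (auto simp: min_cut_cone_def)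
  have s0: "0 \<le> s $ e" for e
    using cut_vector_submodular[of X Y e] by (simp add: s_def)
  have "s $ e = 2" using ab by (simp add: s_def cut_vector_nth[OF e])
  then have "2 * c $ e = c $ e * s $ e" by simp
  also have "\<dots> \<le> (\<Sum>e\<in>UNIV. c $ e * s $ e)"
    using c0 s0 by (intro member_le_sum) auto
  also have "\<dots> = c \<bullet> s" by (simp add: inner_vec_def)
  also have "\<dots> \<le> 0"
  proof -
    have "is_cut (X \<inter> Y)" "is_cut (X \<union> Y)" using assms by (auto simp: is_cut_def)
    then have "c \<bullet> cut_vector X \<le> c \<bullet> cut_vector (X \<inter> Y)"
      "c \<bullet> cut_vector Y \<le> c \<bullet> cut_vector (X \<union> Y)"
      using c by (auto simp: min_cut_cone_def)
    then show ?thesis by (simp add: s_def inner_diff_right inner_add_right)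
  qed
  finally show ?thesis using c0[of e] by (simp add: e_def)
qed

lemma not_adjacent_cuts_crossing:
  fixes X Y :: "'v :: card2 set"
  assumes "X \<inter> Y \<noteq> {}" "X - Y \<noteq> {}" "Y - X \<noteq> {}" "X \<union> Y \<noteq> UNIV"
  shows "\<not> adjacent_cuts {X, - X} {Y, - Y}"
proof -
  obtain a b where ab: "a \<in> X - Y" "b \<in> Y - X" using assms by blast
  obtain p q where pq: "p \<in> X \<inter> Y" "q \<notin> X \<union> Y" using assms by blast
  define e f where "e = Abs_edge {a, b}" and "f = Abs_edge {p, q}"
  have "Rep_edge e = {a, b}" "Rep_edge f = {p, q}"
    using ab pq unfolding e_def f_def by (intro Rep_Abs_edge; blast)+
  then have "e \<noteq> f" using ab pq by (auto simp: doubleton_eq_iff)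
  let ?He = "{c :: real ^ 'v edge. axis e 1 \<bullet> c = 0}"
  let ?Hf = "{c :: real ^ 'v edge. axis f 1 \<bullet> c = 0}"
  have "min_cut_cone X \<inter> min_cut_cone Y \<subseteq> ?He \<inter> ?Hf"
  proof
    fix c assume c: "c \<in> min_cut_cone X \<inter> min_cut_cone Y"
    have "c $ e = 0"
      unfolding e_def using c assms ab by (intro min_cut_cones_vanish_crossing_edge) auto
    \<comment> \<open>Replacing \<open>Y\<close> by \<open>- Y\<close> keeps the cone and puts
      \<open>p\<close> into \<open>X - (- Y)\<close> and \<open>q\<close> into
      \<open>- Y - X\<close>, so the same lemma covers the second kind of edge.\<close>
    moreover have "c $ f = 0"
      unfolding f_def using c assms pq
      by (intro min_cut_cones_vanish_crossing_edge[of c X "- Y"]) (auto simp: min_cut_cone_Compl)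
    ultimately show "c \<in> ?He \<inter> ?Hf" by (simp add: inner_axis')
  qed
  then have "aff_dim (min_cut_cone X \<inter> min_cut_cone Y) \<le> aff_dim (?He \<inter> ?Hf)"
    by (rule aff_dim_subset)
  also have "aff_dim (?He \<inter> ?Hf) = aff_dim ?He - 1"
  proof -
    \<comment> \<open>Intersecting with a hyperplane lowers the dimension by exactly one unless the
      result is empty or nothing is cut off; these points exclude both cases. The face thus has
      dimension at most d - 2, where d is the number of edges.\<close>
    have "0 \<in> ?He \<inter> ?Hf" by simp
    moreover have "axis f 1 \<in> ?He" "axis f 1 \<notin> ?Hf"
      using \<open>e \<noteq> f\<close> by (simp_all add: inner_axis_axis)
    ultimately have "?He \<inter> ?Hf \<noteq> {}" "\<not> ?He \<subseteq> ?Hf" by blast+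
    then show ?thesis
      using aff_dim_affine_Int_hyperplane[OF affine_hyperplane] by metis
  qed
  also have "aff_dim ?He = int (DIM(real ^ 'v edge)) - 1"
    by (simp add: Suc_leI)
  also have "\<dots> = int (CARD('v) choose 2) - 1"
    by (simp add: card_edge)
  finally show ?thesis by (simp add: adjacent_cuts_def cone_of_cut)
qed

section \<open>Distances in the cone graph and the diameter\<close>

text \<open>Non-adjacency rules out disjointness and both inclusions of the representatives. Hence
  \<open>X \<inter> Y\<close> is nonempty and strictly inside each of them, and nesting gives both
  adjacencies.\<close>

lemma common_adjacent_cut:
  assumes "C \<in> cuts" "D \<in> cuts" "C \<noteq> D" "\<not> adjacent_cuts C D"
  obtains A where "A \<in> cuts" "adjacent_cuts C A" "adjacent_cuts A D"
proof -
  obtain X Y where X: "C = {X, - X}" "is_cut X" and Y: "D = {Y, - Y}" "is_cut Y"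
    using assms by (auto simp: cuts_def)
  have XY: "X \<noteq> Y" "X \<noteq> - Y" using assms X Y by (auto simp: cut_pair_eq_iff)
  have X': "X \<noteq> {}" "X \<noteq> UNIV" and Y': "Y \<noteq> {}" "Y \<noteq> UNIV"
    using X Y by (simp_all add: is_cut_def)
  have nonempty: "X \<inter> Y \<noteq> {}"
  proof
    assume "X \<inter> Y = {}"
    \<comment> \<open>Disjoint sets that cover all vertices would be complementary and represent the
      same cut.\<close>
    moreover from this XY have "X \<union> Y \<noteq> UNIV" by blast
    ultimately show False using adjacent_cuts_disjoint[of X Y] X' Y' X Y assms(4) by metis
  qed
  moreover have "\<not> X \<subseteq> Y"
    using adjacent_cuts_psubset[of X Y] X' Y' X Y XY assms(4) by (metis psubsetI)
  moreover have "\<not> Y \<subseteq> X"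
    using adjacent_cuts_psubset[of Y X] adjacent_cuts_commute[of C D] X' Y' X Y XY assms(4)
    by (metis psubsetI)
  ultimately have "X \<inter> Y \<subset> X" "X \<inter> Y \<subset> Y" by blast+
  then have "adjacent_cuts {X \<inter> Y, - (X \<inter> Y)} C" "adjacent_cuts {X \<inter> Y, - (X \<inter> Y)} D"
    unfolding X(1) Y(1) using nonempty X' Y' by (blast intro: adjacent_cuts_psubset)+
  moreover have "{X \<inter> Y, - (X \<inter> Y)} \<in> cuts"
    using nonempty X unfolding cuts_def is_cut_def by blast
  ultimately show thesis using that adjacent_cuts_commute by blast
qed

interpretation cone_graph: graph cone_graph
  by (rule graph_cone_graph)

lemma cone_graph_simps:
  "verts cone_graph = cuts"
  "arcs cone_graph = {(C, D). C \<in> cuts \<and> D \<in> cuts \<and> adjacent_cuts C D}"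
  "tail cone_graph = fst" "head cone_graph = snd"
  by (simp_all add: cone_graph_def)

lemma cone_graph_distance_le_2:
  assumes "C \<in> cuts" "D \<in> cuts"
  shows "cone_graph.\<mu> (\<lambda>_. 1) C D \<le> 2"
proof -
  obtain p where p: "cone_graph.awalk C p D" "length p \<le> 2"
  proof -
    consider "C = D" | "adjacent_cuts C D" | "C \<noteq> D" "\<not> adjacent_cuts C D" by blast
    then show thesis
    proof cases
      case 1
      then show ?thesis
        using that[of "[]"] assms by (simp add: cone_graph.awalk_simps cone_graph_simps)
    next
      case 2
      then show ?thesis
        using that[of "[(C, D)]"] assms by (simp add: cone_graph.awalk_simps cone_graph_simps)
    next
      case 3
      then obtain A where "A \<in> cuts" "adjacent_cuts C A" "adjacent_cuts A D"
        using common_adjacent_cut assms by blast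
      then show ?thesis
        using that[of "[(C, A), (A, D)]"] assms
        by (simp add: cone_graph.awalk_simps cone_graph_simps)
    qed
  qed
  have "cone_graph.\<mu> (\<lambda>_. 1) C D \<le> cone_graph.awalk_cost (\<lambda>_. 1) p"
    using p(1) by (rule cone_graph.min_cost_le_walk_cost)
  also have "cone_graph.awalk_cost (\<lambda>_. 1) p = length p" by (induction p) simp_all
  also have "ereal (length p) \<le> 2" using p(2) by simp
  finally show ?thesis .
qed

text \<open>The distance is an infimum over walks, so each walk is bounded separately: length 0
  forces equal endpoints and length 1 forces adjacency.\<close>

lemma cone_graph_distance_ge_2:
  assumes "C \<noteq> D" "\<not> adjacent_cuts C D"
  shows "2 \<le> cone_graph.\<mu> (\<lambda>_. 1) C D"
  unfolding cone_graph.\<mu>_def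
proof (rule INF_greatest)
  fix p assume "p \<in> {p. cone_graph.awalk C p D}"
  then have "length p \<noteq> 0" "length p \<noteq> 1"
    using assms by (auto simp: length_Suc_conv cone_graph.awalk_simps cone_graph_simps)
  then have "2 \<le> length p" by linarith
  moreover have "cone_graph.awalk_cost (\<lambda>_. 1) p = length p" by (induction p) simp_all
  ultimately show "2 \<le> ereal (cone_graph.awalk_cost (\<lambda>_. 1) p)" by simp
qed

theorem theorem4:
  assumes "CARD('v :: card2) \<ge> 4"
  shows "graph_diameter (cone_graph :: ('v set set, 'v set set \<times> 'v set set) pre_digraph) = 2"
proof (rule antisym)
  show "graph_diameter (cone_graph :: ('v set set, 'v set set \<times> 'v set set) pre_digraph) \<le> 2"
    unfolding graph_diameter_def cone_graph_simps
    by (intro SUP_least cone_graph_distance_le_2)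
  obtain S :: "'v set" where "card S = 4"
    using assms by (metis obtain_subset_with_card_n)
  then obtain a b c d :: 'v where abcd: "distinct [a, b, c, d]"
    by (auto simp: card_Suc_eq numeral_eq_Suc)
  \<comment> \<open>The four vertices occupy the four regions of a crossing pair: \<open>a\<close>
    in both sets, \<open>b\<close> only in \<open>X\<close>, \<open>c\<close> only in
    \<open>Y\<close>, \<open>d\<close> in neither. This is where four vertices are required.\<close>
  define X Y where "X = {a, b}" and "Y = {a, c}"
  have "c \<notin> X" "b \<notin> Y" "d \<notin> X" "d \<notin> Y" using abcd by (auto simp: X_def Y_def)
  then have cross: "X \<inter> Y \<noteq> {}" "X - Y \<noteq> {}" "Y - X \<noteq> {}" "X \<union> Y \<noteq> UNIV"
    by (auto simp: X_def Y_def)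
  then have "{X, - X} \<in> cuts" "{Y, - Y} \<in> cuts" "{X, - X} \<noteq> {Y, - Y}"
    unfolding cut_pair_eq_iff by (auto simp: cuts_def is_cut_def)
  then have "2 \<le> cone_graph.\<mu> (\<lambda>_. 1) {X, - X} {Y, - Y}"
    by (intro cone_graph_distance_ge_2 not_adjacent_cuts_crossing cross)
  also have "\<dots> \<le> (SUP D\<in>cuts. cone_graph.\<mu> (\<lambda>_. 1) {X, - X} D)"
    by (rule SUP_upper) fact
  also have "\<dots> \<le> graph_diameter (cone_graph :: ('v set set, 'v set set \<times> 'v set set) pre_digraph)"
    unfolding graph_diameter_def cone_graph_simps by (rule SUP_upper) fact
  finally show "2 \<le> graph_diameter (cone_graph :: ('v set set, 'v set set \<times> 'v set set) pre_digraph)" .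
qed

end
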